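(* Let $d\in\mathbb{Z}_+$. For each $t\in(0,2^{-8})$ and all $\xi\in\mathbb{T}^d$, $$H_t(0)\exp\Big(-\frac{|\xi|^2}{4t}\Big)\le H_t(\xi)\le H_t(0)\exp\Big(-\frac{|\xi|^2}{40t}\Big).$$ Additionally, for all $t\ge 2^{-8}$ and $\xi\in\mathbb{T}^d$, $$H_t(0)\exp\Big(-256\big(\pi^3+1024\,\pi\, e^{-\pi/64}\big)e^{-4\pi^2t}|\xi|^2\Big)\le H_t(\xi)\le H_t(0)\exp\Big(-\frac{16}{1+4\sqrt2}\,e^{-4\pi^2t}|\xi|^2\Big).$$
   Context: $\mathbb{Z}_+=\{1,2,\dots\}$. The torus $\mathbb{T}^d=\mathbb{R}^d/\mathbb{Z}^d$ is identified with $[-1/2,1/2)^d$, and $|\xi|$ is the Euclidean norm of the representative $\xi\in[-1/2,1/2)^d$. For $t>0$ and $\xi\in\mathbb{T}^d$, $$H_t(\xi)=(4\pi t)^{-d/2}\sum_{n\in\mathbb{Z}^d}\exp\Big(-\frac{|n-\xi|^2}{4t}\Big)$$ is the heat kernel on $\mathbb{T}^d$. *)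

theory Defs
  imports "HOL-Analysis.Analysis"
begin

definition int_lattice :: "(real ^ 'n) set" where
  "int_lattice = {n. \<forall>i. n $ i \<in> \<int>}"

(* Fundamental domain identified with the torus R^d / Z^d, where d = CARD('n);
   the norm of a point of the torus is the norm of this representative. *)
definition torus :: "(real ^ 'n) set" where
  "torus = {\<xi>. \<forall>i. - 1/2 \<le> \<xi> $ i \<and> \<xi> $ i < 1/2}"

(* Defined on all of R^d, where it is Z^d-periodic. The series of positive terms
   converges for every t > 0, so infsum is then the actual sum. *)
definition heat_kernel :: "real \<Rightarrow> real ^ 'n \<Rightarrow> real" where
  "heat_kernel t \<xi> =
     (4 * pi * t) powr (- real CARD('n) / 2) *
     (\<Sum>\<^sub>\<infinity>n\<in>int_lattice. exp (- (norm (n - \<xi>))\<^sup>2 / (4 * t)))"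

end

theory Submission
  imports Defs "HOL-Probability.Characteristic_Functions"
begin

text \<open>The heat kernel of the torus is a product, over the coordinates, of heat kernels of the circle, and all
four bounds are Gaussian in \<open>|\<xi>|^2\<close>, the sum of the squares of the coordinates. It is therefore enough to
compare \<open>\<theta>(x)\<close> and \<open>\<theta>(0)\<close> for \<open>|x| \<le> 1/2\<close>, where \<open>\<theta>(x)\<close> is the sum of \<open>e^{-a (n - x)^2}\<close> over the integers
and \<open>a = 1 / (4 t)\<close> (\<open>heat_kernel_eq_prod\<close>, \<open>heat_kernel_le\<close>, \<open>heat_kernel_ge\<close>).

Pairing \<open>n\<close> with \<open>-n\<close> gives \<open>\<theta>(x) e^{a x^2} = 1 + 2 \<Sum> e^{-a n^2} cosh (2 a n x)\<close>, summed over \<open>n \<ge> 1\<close>. As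
\<open>cosh \<ge> 1\<close>, this yields \<open>\<theta>(0) e^{-a x^2} \<le> \<theta>(x)\<close> at all times (\<open>gauss_sum_ge\<close>). For \<open>a \<ge> 64\<close> the weights
\<open>e^{-a n^2}\<close> are so small that the sum grows more slowly than \<open>e^{9 a x^2 / 10}\<close>, which is the short-time upper
bound (\<open>gauss_sum_le_small_time\<close>).

At long times \<open>\<theta>\<close> is nearly constant and its variation is visible only on the Fourier side. The Poisson
summation formula (\<open>theta_transformation\<close>) makes \<open>\<theta>(x)\<close> a multiple of
\<open>g(x) = 1 + 2 \<Sum> q^{n^2} cos (2 \<pi> n x)\<close> with \<open>q = e^{-4 \<pi>^2 t}\<close>. It is proved by comparing cosine
coefficients, those of \<open>\<theta>\<close> being values of the Fourier transform of a Gaussian, and by the uniqueness of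
a continuous symmetric function with given coefficients. Now \<open>g(0) - g(x)\<close> is a sum of nonnegative
terms: its first term gives the upper bound for \<open>\<theta>(x) / \<theta>(0)\<close> once \<open>g(0) \<le> 1 + 4 \<surd>2\<close> is known (\<open>cos_sum_le\<close>),
and \<open>1 - cos y \<le> y^2 / 2\<close> gives the lower bound for \<open>t \<ge> 1/8\<close> (\<open>cos_sum_ge\<close>). Between \<open>1/256\<close> and \<open>1/8\<close>
the elementary lower bound above is already stronger than the asserted one.\<close>

section \<open>Sums over the integers\<close>

lemma UNIV_int_split: "(UNIV :: int set) = {0} \<union> (range (\<lambda>n. int (Suc n)) \<union> range (\<lambda>n. - int (Suc n)))"
proof -
  have "n \<in> {0} \<union> (range (\<lambda>n. int (Suc n)) \<union> range (\<lambda>n. - int (Suc n)))" for n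
  proof -
    consider "n = 0" | m where "n = int (Suc m)" | m where "n = - int (Suc m)"
      by (metis int_cases3 not0_implies_Suc less_irrefl of_nat_0_less_iff)
    thus ?thesis by cases blast+
  qed
  thus ?thesis by blast
qed

text \<open>The Gaussian and the cosine series are naturally indexed by the integers but are estimated and
evaluated by pairing \<open>n\<close> with \<open>-n\<close>. This lemma and the next translate between the two forms; only the
present direction has to create unconditional convergence, which positivity of the summands supplies.\<close>
lemma int_has_sum_of_sums:
  fixes f :: "int \<Rightarrow> real"
  assumes nonneg: "\<And>n. 0 \<le> f n" and sums: "(\<lambda>n. f (int (Suc n)) + f (- int (Suc n))) sums s"
  shows "(f has_sum (f 0 + s)) UNIV"
proof -
  have sm: "summable (\<lambda>n. f (int (Suc n)) + f (- int (Suc n)))"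
    using sums by (rule sums_summable)
  \<comment> \<open>Each half is dominated by the paired series because the summands are nonnegative.\<close>
  have 1: "summable (\<lambda>n. f (int (Suc n)))" and 2: "summable (\<lambda>n. f (- int (Suc n)))"
    by (rule summable_comparison_test'[OF sm, of 0]; use nonneg in \<open>simp add: add_increasing add_increasing2\<close>)+
  have s: "s = (\<Sum>n. f (int (Suc n))) + (\<Sum>n. f (- int (Suc n)))"
    using sums suminf_add[OF 1 2] by (simp add: sums_iff)
  have h1: "((f \<circ> (\<lambda>n. int (Suc n))) has_sum (\<Sum>n. f (int (Suc n)))) UNIV"
    unfolding o_def by (rule sums_nonneg_imp_has_sum[OF summable_sums[OF 1] nonneg])
  have h2: "((f \<circ> (\<lambda>n. - int (Suc n))) has_sum (\<Sum>n. f (- int (Suc n)))) UNIV"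
    unfolding o_def by (rule sums_nonneg_imp_has_sum[OF summable_sums[OF 2] nonneg])
  have h1': "(f has_sum (\<Sum>n. f (int (Suc n)))) (range (\<lambda>n. int (Suc n)))"
    by (rule has_sum_reindex[THEN iffD2, OF _ h1]) (auto simp: inj_on_def)
  have h2': "(f has_sum (\<Sum>n. f (- int (Suc n)))) (range (\<lambda>n. - int (Suc n)))"
    by (rule has_sum_reindex[THEN iffD2, OF _ h2]) (auto simp: inj_on_def)
  have h3: "(f has_sum f 0) {0}" by (simp add: has_sum_finite_iff)
  have h12: "(f has_sum s) (range (\<lambda>n. int (Suc n)) \<union> range (\<lambda>n. - int (Suc n)))"
    unfolding s by (rule has_sum_Un_disjoint[OF h1' h2']) auto
  show ?thesis
    unfolding UNIV_int_split by (rule has_sum_Un_disjoint[OF h3 h12]) auto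
qed

lemma int_sums_of_has_sum:
  fixes f :: "int \<Rightarrow> real"
  assumes S: "(f has_sum S) UNIV"
  shows "(\<lambda>n. f (int (Suc n)) + f (- int (Suc n))) sums (S - f 0)"
proof -
  have sm: "f summable_on A" for A
    using summable_on_subset[OF has_sum_imp_summable[OF S], of A] by simp
  define P N where "P = range (\<lambda>n. int (Suc n))" and "N = range (\<lambda>n. - int (Suc n))"
  have "((f \<circ> (\<lambda>n. int (Suc n))) has_sum infsum f P) UNIV"
    using has_sum_infsum[OF sm[of P]] unfolding P_def
    by (subst (asm) has_sum_reindex) (auto simp: inj_on_def)
  moreover have "((f \<circ> (\<lambda>n. - int (Suc n))) has_sum infsum f N) UNIV"
    using has_sum_infsum[OF sm[of N]] unfolding N_def
    by (subst (asm) has_sum_reindex) (auto simp: inj_on_def)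
  ultimately have "(\<lambda>n. f (int (Suc n)) + f (- int (Suc n))) sums (infsum f P + infsum f N)"
    unfolding o_def by (intro sums_add has_sum_imp_sums)
  moreover have "(f has_sum (f 0 + (infsum f P + infsum f N))) UNIV"
    unfolding UNIV_int_split P_def[symmetric] N_def[symmetric]
    by (intro has_sum_Un_disjoint has_sum_infsum sm) (auto simp: P_def N_def has_sum_finite_iff)
  hence "S - f 0 = infsum f P + infsum f N" using has_sum_unique[OF S] by simp
  ultimately show ?thesis by simp
qed

section \<open>Gaussian sums and their bounds at short times\<close>

text \<open>Up to the factor \<open>(4 \<pi> t) powr (-1/2)\<close>, this is the heat kernel of the circle at time \<open>t = 1 / (4 a)\<close>;
it is a Jacobi theta function.\<close>
definition gauss_sum :: "real \<Rightarrow> real \<Rightarrow> real" where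
  "gauss_sum a x = (\<Sum>\<^sub>\<infinity>n\<in>(UNIV :: int set). exp (- a * (of_int n - x)\<^sup>2))"

lemma cosh_le_exp: "0 \<le> y \<Longrightarrow> cosh y \<le> exp (y :: real)"
  by (simp add: cosh_def)

lemma summable_gauss_cosh:
  fixes a x :: real
  assumes "0 < a"
  shows "summable (\<lambda>n. exp (- a * (real (Suc n))\<^sup>2) * cosh (2 * a * real (Suc n) * x))"
proof (rule summable_comparison_test')
  define r where "r = exp (- a)"
  have r: "0 < r" "r < 1" using assms by (auto simp: r_def)
  show "summable (\<lambda>n. exp (a * (\<bar>x\<bar> + 1)\<^sup>2) * r ^ n)"
    using r by (intro summable_mult summable_geometric) auto
  fix n :: nat
  let ?m = "real (Suc n)"
  have "cosh (2 * a * ?m * x) \<le> exp \<bar>2 * a * ?m * x\<bar>"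
    using cosh_le_exp[of "\<bar>2 * a * ?m * x\<bar>"] by simp
  also have "\<dots> = exp (2 * a * ?m * \<bar>x\<bar>)" using assms by (simp add: abs_mult)
  finally have "exp (- a * ?m\<^sup>2) * cosh (2 * a * ?m * x) \<le> exp (- a * ?m\<^sup>2 + 2 * a * ?m * \<bar>x\<bar>)"
    unfolding exp_add by (intro mult_left_mono) auto
  also have "\<dots> \<le> exp (a * (\<bar>x\<bar> + 1)\<^sup>2 + real n * (- a))"
  proof -
    \<comment> \<open>Completing the square, so that the linear growth in \<open>n\<close> is left over.\<close>
    have "0 \<le> (real (Suc n) - \<bar>x\<bar> - 1/2)\<^sup>2 + \<bar>x\<bar> + 7/4" by simp
    hence "- ?m\<^sup>2 + 2 * ?m * \<bar>x\<bar> \<le> (\<bar>x\<bar> + 1)\<^sup>2 - real n"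
      by (simp add: power2_eq_square algebra_simps)
    hence "a * (- ?m\<^sup>2 + 2 * ?m * \<bar>x\<bar>) \<le> a * ((\<bar>x\<bar> + 1)\<^sup>2 - real n)"
      using assms by (intro mult_left_mono) auto
    thus ?thesis by (simp add: algebra_simps)
  qed
  also have "\<dots> = exp (a * (\<bar>x\<bar> + 1)\<^sup>2) * r ^ n"
    unfolding r_def exp_add by (simp only: exp_of_nat_mult)
  finally show "norm (exp (- a * ?m\<^sup>2) * cosh (2 * a * ?m * x)) \<le> exp (a * (\<bar>x\<bar> + 1)\<^sup>2) * r ^ n"
    by simp
qed

text \<open>Factoring out the Gaussian of the lattice point \<open>0\<close> isolates the quantity \<open>\<theta>(x) e^{a x^2}\<close>, a sum of
hyperbolic cosines, which is smallest at \<open>x = 0\<close> and whose growth in \<open>x\<close> is easy to control.\<close>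
lemma gauss_sum_has_sum_cosh:
  fixes a x :: real
  assumes "0 < a"
  shows "((\<lambda>n::int. exp (- a * (of_int n - x)\<^sup>2)) has_sum
    exp (- a * x\<^sup>2) * (1 + 2 * (\<Sum>n. exp (- a * (real (Suc n))\<^sup>2) * cosh (2 * a * real (Suc n) * x)))) UNIV"
proof -
  let ?f = "\<lambda>n::int. exp (- a * (of_int n - x)\<^sup>2)"
  let ?c = "\<lambda>n. exp (- a * (real (Suc n))\<^sup>2) * cosh (2 * a * real (Suc n) * x)"
  have pair: "?f (int (Suc n)) + ?f (- int (Suc n)) = exp (- a * x\<^sup>2) * 2 * ?c n" for n
  proof -
    have "?f (int (Suc n)) = exp (- a * x\<^sup>2 + (- a * (real (Suc n))\<^sup>2 + 2 * a * real (Suc n) * x))"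
      "?f (- int (Suc n)) = exp (- a * x\<^sup>2 + (- a * (real (Suc n))\<^sup>2 + - (2 * a * real (Suc n) * x)))"
      by (simp_all add: power2_eq_square algebra_simps)
    thus ?thesis unfolding exp_add cosh_def by (simp add: algebra_simps)
  qed
  have "(\<lambda>n. ?f (int (Suc n)) + ?f (- int (Suc n))) sums (exp (- a * x\<^sup>2) * 2 * (\<Sum>n. ?c n))"
    unfolding pair by (intro sums_mult summable_sums summable_gauss_cosh assms)
  from int_has_sum_of_sums[of ?f, OF _ this] show ?thesis
    by (simp add: algebra_simps)
qed

lemmas gauss_sum_eq_cosh = gauss_sum_has_sum_cosh[THEN infsumI, folded gauss_sum_def]
lemmas gauss_summable_on = gauss_sum_has_sum_cosh[THEN has_sum_imp_summable]

lemma gauss_sum_minus: "gauss_sum a (- x) = gauss_sum a x"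
proof -
  have "gauss_sum a (- x) = infsum ((\<lambda>n. exp (- a * (of_int n - x)\<^sup>2)) \<circ> uminus) (UNIV :: int set)"
    unfolding gauss_sum_def o_def by (intro infsum_cong) (simp add: power2_eq_square algebra_simps)
  also have "\<dots> = gauss_sum a x"
    unfolding gauss_sum_def by (subst infsum_reindex[symmetric]) auto
  finally show ?thesis .
qed

lemma gauss_sum_abs: "gauss_sum a \<bar>x\<bar> = gauss_sum a x"
  by (simp add: abs_if gauss_sum_minus)

lemma gauss_sum_reflect: "gauss_sum a (1 - x) = gauss_sum a x"
proof -
  have "gauss_sum a (1 - x) = infsum ((\<lambda>n. exp (- a * (of_int n - x)\<^sup>2)) \<circ> (\<lambda>n. 1 - n)) (UNIV :: int set)"
    unfolding gauss_sum_def o_def by (intro infsum_cong) (simp add: power2_eq_square algebra_simps)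
  also have "\<dots> = infsum (\<lambda>n. exp (- a * (of_int n - x)\<^sup>2)) (range (\<lambda>n::int. 1 - n))"
    by (subst infsum_reindex[symmetric]) (auto simp: inj_on_def)
  also have "range (\<lambda>n::int. 1 - n) = UNIV" by (rule surjI[of _ "\<lambda>n. 1 - n"]) simp
  finally show ?thesis by (simp add: gauss_sum_def)
qed

lemma gauss_sum_nonneg: "0 \<le> gauss_sum a x"
  unfolding gauss_sum_def by (intro infsum_nonneg) auto

lemma gauss_sum_ge_one: "0 < a \<Longrightarrow> 1 \<le> gauss_sum a 0"
  by (simp add: gauss_sum_eq_cosh suminf_nonneg summable_gauss_cosh[of a 0, simplified])

text \<open>Every hyperbolic cosine is at least its value at \<open>0\<close>.\<close>
lemma gauss_sum_ge:
  assumes "0 < a" shows "gauss_sum a 0 * exp (- a * x\<^sup>2) \<le> gauss_sum a x"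
proof -
  have "(\<Sum>n. exp (- a * (real (Suc n))\<^sup>2) * cosh (2 * a * real (Suc n) * 0))
      \<le> (\<Sum>n. exp (- a * (real (Suc n))\<^sup>2) * cosh (2 * a * real (Suc n) * x))"
    by (intro suminf_le summable_gauss_cosh assms mult_left_mono) (auto simp: cosh_real_ge_1)
  thus ?thesis using assms
    by (simp add: gauss_sum_eq_cosh mult.commute)
qed

lemma exp_minus_le_sixteenth:
  fixes b :: real
  assumes "4 \<le> b"
  shows "exp (- b) \<le> 1 / 16"
proof -
  have "(16::real) \<le> exp 1 ^ 4"
    using power_mono[of 2 "exp (1::real)" 4] exp_ge_add_one_self[of "1::real"] by simp
  also have "\<dots> = exp 4" by (simp flip: exp_of_nat_mult)
  also have "\<dots> \<le> exp b" using assms by simp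
  finally show ?thesis by (simp add: exp_minus field_simps)
qed

text \<open>Since \<open>n^2 \<le> 4^(n-1)\<close> and \<open>e^{-b} \<le> 1/16\<close>, the second moment of the Gaussian weights is dominated by a
geometric series, so that its first term determines its size. The same estimate serves the Gaussian
sum at short times and the cosine sum at long times.\<close>
lemma gauss_second_moment_term_le:
  fixes b :: real
  assumes "4 \<le> b"
  shows "(real (Suc n))\<^sup>2 * exp (- b * (real (Suc n))\<^sup>2) \<le> exp (- b) * (1 / 4) ^ n"
proof -
  have "real n < 2 ^ n" by (rule of_nat_less_two_power)
  hence "real (Suc n) \<le> 2 ^ n" by (metis Suc_leI less_exp of_nat_le_iff of_nat_numeral of_nat_power)
  hence "(real (Suc n))\<^sup>2 \<le> (2 ^ n)\<^sup>2" by (intro power_mono) auto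
  also have "(2 ^ n)\<^sup>2 = (4::real) ^ n" by (simp add: power2_eq_square flip: power_mult_distrib)
  finally have sq: "(real (Suc n))\<^sup>2 \<le> 4 ^ n" .
  note q = exp_minus_le_sixteenth[OF assms]
  have "real n \<le> real n * real n" by (cases n) auto
  hence "- b * (real (Suc n))\<^sup>2 \<le> - b + real n * (- b)"
  proof -
    have "b * (1 + real n) \<le> b * (real (Suc n))\<^sup>2"
      using assms by (intro mult_left_mono) (auto simp: power2_eq_square algebra_simps)
    thus ?thesis by (simp add: algebra_simps)
  qed
  hence "exp (- b * (real (Suc n))\<^sup>2) \<le> exp (- b + real n * (- b))" by simp
  also have "\<dots> = exp (- b) * exp (- b) ^ n" unfolding exp_add by (simp only: exp_of_nat_mult)
  also have "\<dots> \<le> exp (- b) * (1 / 16) ^ n"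
    by (intro mult_left_mono power_mono q) auto
  finally have "(real (Suc n))\<^sup>2 * exp (- b * (real (Suc n))\<^sup>2) \<le> 4 ^ n * (exp (- b) * (1 / 16) ^ n)"
    using sq by (intro mult_mono) auto
  also have "\<dots> = exp (- b) * (1 / 4) ^ n"
    by (simp flip: power_mult_distrib add: mult.left_commute)
  finally show ?thesis .
qed

lemma gauss_second_moment_le:
  fixes b :: real
  assumes "4 \<le> b"
  shows "summable (\<lambda>n. (real (Suc n))\<^sup>2 * exp (- b * (real (Suc n))\<^sup>2))"
    and "(\<Sum>n. (real (Suc n))\<^sup>2 * exp (- b * (real (Suc n))\<^sup>2)) \<le> 4 / 3 * exp (- b)"
proof -
  have g: "(\<lambda>n. exp (- b) * (1 / 4) ^ n) sums (exp (- b) * (1 / (1 - 1 / 4)))"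
    by (intro sums_mult geometric_sums) simp
  show s: "summable (\<lambda>n. (real (Suc n))\<^sup>2 * exp (- b * (real (Suc n))\<^sup>2))"
    by (rule summable_comparison_test'[OF sums_summable[OF g], of 0])
      (use gauss_second_moment_term_le[OF assms] in auto)
  show "(\<Sum>n. (real (Suc n))\<^sup>2 * exp (- b * (real (Suc n))\<^sup>2)) \<le> 4 / 3 * exp (- b)"
    using suminf_le[OF gauss_second_moment_term_le[OF assms] s sums_summable[OF g]] sums_unique[OF g]
    by simp
qed

text \<open>From \<open>cosh y - 1 = 2 (sinh (y/2))^2\<close> and \<open>sinh z \<le> z e^z\<close>.\<close>
lemma cosh_minus_one_le:
  fixes y :: real
  assumes "0 \<le> y"
  shows "2 * (cosh y - 1) \<le> y\<^sup>2 * exp y"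
proof -
  define z where "z = y / 2"
  have "sinh z = exp z * (1 - exp (- 2 * z)) / 2"
    by (simp add: sinh_def algebra_simps flip: exp_add)
  also have "\<dots> \<le> exp z * (2 * z) / 2"
    using exp_ge_add_one_self[of "- 2 * z"] by (intro divide_right_mono mult_left_mono) auto
  finally have s: "sinh z \<le> z * exp z" by (simp add: mult.commute)
  have "2 * (cosh y - 1) = 4 * (sinh z)\<^sup>2"
    using cosh_double_cosh[of z] by (simp add: z_def sinh_square_eq)
  also have "\<dots> \<le> 4 * (z * exp z)\<^sup>2"
    using s assms by (intro mult_left_mono power_mono) (auto simp: z_def)
  also have "\<dots> = y\<^sup>2 * exp y"
    by (simp add: z_def power2_eq_square flip: exp_add)
  finally show ?thesis .
qed

text \<open>For \<open>x \<le> 1/4\<close> the increase of \<open>cosh (2 a n x)\<close> above \<open>1\<close> is quadratic in \<open>x\<close>, with an extra factor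
\<open>e^{2 a n x} \<le> e^{a n^2 / 2}\<close> that costs only half of the Gaussian weight. What remains is the second
moment with parameter \<open>a / 2\<close>, which is exponentially small in \<open>a\<close>.\<close>
lemma gauss_sum_le_near:
  fixes a x :: real
  assumes a: "64 \<le> a" and x: "0 \<le> x" "x \<le> 1 / 4"
  shows "gauss_sum a x * exp (a * x\<^sup>2) \<le> gauss_sum a 0 + 9 / 10 * a * x\<^sup>2"
proof -
  let ?c = "\<lambda>x n. exp (- a * (real (Suc n))\<^sup>2) * cosh (2 * a * real (Suc n) * x)"
  let ?m = "\<lambda>n. (real (Suc n))\<^sup>2 * exp (- (a / 2) * (real (Suc n))\<^sup>2)"
  have a2: "4 \<le> a / 2" using a by simp
  have le: "2 * (?c x n - ?c 0 n) \<le> 4 * a\<^sup>2 * x\<^sup>2 * ?m n" for n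
  proof -
    let ?N = "real (Suc n)"
    have "2 * (cosh (2 * a * ?N * x) - 1) \<le> (2 * a * ?N * x)\<^sup>2 * exp (2 * a * ?N * x)"
      using a x by (intro cosh_minus_one_le) auto
    hence "exp (- a * ?N\<^sup>2) * (2 * (cosh (2 * a * ?N * x) - 1))
        \<le> exp (- a * ?N\<^sup>2) * ((2 * a * ?N * x)\<^sup>2 * exp (2 * a * ?N * x))"
      by (intro mult_left_mono) auto
    also have "\<dots> = (2 * a * ?N * x)\<^sup>2 * exp (- a * ?N\<^sup>2 + 2 * a * ?N * x)"
      unfolding exp_add by (simp only: mult_ac)
    also have "\<dots> \<le> (2 * a * ?N * x)\<^sup>2 * exp (- (a / 2) * ?N\<^sup>2)"
    proof -
      have "?N * (4 * x) \<le> ?N * ?N" using x by (intro mult_left_mono) auto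
      hence "a / 2 * (?N * (4 * x)) \<le> a / 2 * (?N * ?N)" using a by (intro mult_left_mono) auto
      hence "- a * ?N\<^sup>2 + 2 * a * ?N * x \<le> - (a / 2) * ?N\<^sup>2"
        by (simp add: power2_eq_square field_simps)
      thus ?thesis by (intro mult_left_mono) auto
    qed
    also have "\<dots> = 4 * a\<^sup>2 * x\<^sup>2 * ?m n" by (simp add: power_mult_distrib)
    also have "exp (- a * ?N\<^sup>2) * (2 * (cosh (2 * a * ?N * x) - 1)) = 2 * (?c x n - ?c 0 n)"
      by (simp add: algebra_simps)
    finally show ?thesis .
  qed
  have sc: "summable (?c y)" for y using a by (intro summable_gauss_cosh) auto
  have "2 * (suminf (?c x) - suminf (?c 0)) = (\<Sum>n. 2 * (?c x n - ?c 0 n))"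
    using sc by (simp only: suminf_diff suminf_mult summable_diff)
  also have "\<dots> \<le> (\<Sum>n. 4 * a\<^sup>2 * x\<^sup>2 * ?m n)"
    by (intro suminf_le le summable_mult summable_diff sc gauss_second_moment_le a2)
  also have "\<dots> = 4 * a\<^sup>2 * x\<^sup>2 * suminf ?m"
    by (intro suminf_mult gauss_second_moment_le a2)
  also have "\<dots> \<le> 4 * a\<^sup>2 * x\<^sup>2 * (4 / 3 * exp (- (a / 2)))"
    by (intro mult_left_mono gauss_second_moment_le a2) auto
  also have "\<dots> \<le> 4 * a\<^sup>2 * x\<^sup>2 * (4 / 3 * (8 / a\<^sup>2))"
  proof -
    have "(a / 2)\<^sup>2 / 2 \<le> exp (a / 2)"
      using exp_lower_Taylor_quadratic[of "a / 2"] a by simp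
    hence "exp (- (a / 2)) \<le> 8 / a\<^sup>2" using a
      by (simp add: exp_minus field_simps)
    thus ?thesis by (intro mult_left_mono) auto
  qed
  also have "\<dots> = 128 / 3 * x\<^sup>2" using a by simp
  also have "\<dots> \<le> 9 / 10 * a * x\<^sup>2" using a by (intro mult_right_mono) auto
  finally have *: "2 * suminf (?c x) \<le> 2 * suminf (?c 0) + 9 / 10 * a * x\<^sup>2" by simp
  have "gauss_sum a x * exp (a * x\<^sup>2) = 1 + 2 * suminf (?c x)"
    using a by (simp add: gauss_sum_eq_cosh exp_minus)
  also have "\<dots> \<le> 1 + 2 * suminf (?c 0) + 9 / 10 * a * x\<^sup>2" using * by simp
  also have "1 + 2 * suminf (?c 0) = gauss_sum a 0" using a by (simp add: gauss_sum_eq_cosh)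
  finally show ?thesis .
qed

text \<open>Near \<open>x = 1/2\<close> the quadratic expansion fails because the lattice point \<open>1\<close> contributes as much as \<open>0\<close>.
There a constant bound is enough: the Gaussian decay that has to be proved leaves a spare factor
\<open>e^{9 a x^2 / 10}\<close>, which is already larger than \<open>4\<close> when \<open>x \<ge> 1/4\<close>.\<close>
lemma gauss_sum_le_far:
  fixes a x :: real
  assumes a: "64 \<le> a" and x: "0 \<le> x" "x \<le> 1 / 2"
  shows "gauss_sum a x * exp (a * x\<^sup>2) \<le> 4"
proof -
  let ?c = "\<lambda>n. exp (- a * (real (Suc n))\<^sup>2) * cosh (2 * a * real (Suc n) * x)"
  have q: "exp (- a) \<le> 1 / 4"
  proof -
    have "4 \<le> exp a" using exp_ge_add_one_self[of a] a by linarith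
    thus ?thesis by (simp add: exp_minus field_simps)
  qed
  have le: "?c n \<le> (1 / 4) ^ n" for n
  proof -
    let ?N = "real (Suc n)"
    have "?c n \<le> exp (- a * ?N\<^sup>2) * exp (2 * a * ?N * x)"
      using a x by (intro mult_left_mono cosh_le_exp) auto
    also have "\<dots> = exp (- a * ?N\<^sup>2 + 2 * a * ?N * x)" by (simp only: exp_add)
    also have "\<dots> \<le> exp (real n * (- a))"
    proof -
      have "real n \<le> real n * real n" by (cases n) auto
      moreover have "?N * (2 * x) \<le> ?N * 1" using x by (intro mult_left_mono) auto
      ultimately have "- (?N * ?N) + ?N * (2 * x) \<le> - real n" by (simp add: algebra_simps)
      hence "a * (- (?N * ?N) + ?N * (2 * x)) \<le> a * (- real n)" using a by (intro mult_left_mono) auto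
      thus ?thesis by (simp add: power2_eq_square algebra_simps)
    qed
    also have "\<dots> = exp (- a) ^ n" by (simp only: exp_of_nat_mult)
    also have "\<dots> \<le> (1 / 4) ^ n" by (intro power_mono q) auto
    finally show ?thesis .
  qed
  have g: "(\<lambda>n. (1 / 4 :: real) ^ n) sums (1 / (1 - 1 / 4))" by (rule geometric_sums) simp
  have "suminf ?c \<le> 4 / 3"
    using suminf_le[OF le summable_gauss_cosh sums_summable[OF g]] sums_unique[OF g] a by simp
  moreover have "gauss_sum a x * exp (a * x\<^sup>2) = 1 + 2 * suminf ?c"
    using a by (simp add: gauss_sum_eq_cosh exp_minus)
  ultimately show ?thesis by simp
qed

lemma gauss_sum_le_small_time:
  fixes a x :: real
  assumes a: "64 \<le> a" and x: "\<bar>x\<bar> \<le> 1 / 2"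
  shows "gauss_sum a x \<le> gauss_sum a 0 * exp (- (a / 10) * x\<^sup>2)"
proof -
  have main: "gauss_sum a y * exp (a * y\<^sup>2) \<le> gauss_sum a 0 * exp (9 / 10 * a * y\<^sup>2)"
    if y: "0 \<le> y" "y \<le> 1 / 2" for y
  proof (cases "y \<le> 1 / 4")
    case True
    have g: "1 \<le> gauss_sum a 0" using a by (intro gauss_sum_ge_one) auto
    have "gauss_sum a y * exp (a * y\<^sup>2) \<le> gauss_sum a 0 + 1 * (9 / 10 * a * y\<^sup>2)"
      using gauss_sum_le_near[OF a y(1) True] by simp
    also have "\<dots> \<le> gauss_sum a 0 + gauss_sum a 0 * (9 / 10 * a * y\<^sup>2)"
      using g a by (intro add_left_mono mult_right_mono) auto
    also have "\<dots> = gauss_sum a 0 * (1 + 9 / 10 * a * y\<^sup>2)" by (simp add: algebra_simps)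
    also have "\<dots> \<le> gauss_sum a 0 * exp (9 / 10 * a * y\<^sup>2)"
      using g by (intro mult_left_mono exp_ge_add_one_self) auto
    finally show ?thesis .
  next
    case False
    have "(1 / 4)\<^sup>2 \<le> y\<^sup>2" using False by (intro power_mono) auto
    hence "64 * (1 / 4)\<^sup>2 \<le> a * y\<^sup>2" using a by (intro mult_mono) auto
    hence "4 \<le> 1 + 9 / 10 * a * y\<^sup>2" by (simp add: power2_eq_square)
    also have "\<dots> \<le> exp (9 / 10 * a * y\<^sup>2)" by (rule exp_ge_add_one_self)
    also have "\<dots> \<le> gauss_sum a 0 * exp (9 / 10 * a * y\<^sup>2)"
      using gauss_sum_ge_one[of a] a by simp
    finally show ?thesis using gauss_sum_le_far[OF a y] by linarith
  qed
  have "gauss_sum a x = gauss_sum a \<bar>x\<bar> * exp (a * \<bar>x\<bar>\<^sup>2) * exp (- a * x\<^sup>2)"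
    by (simp add: gauss_sum_abs exp_minus)
  also have "\<dots> \<le> gauss_sum a 0 * exp (9 / 10 * a * \<bar>x\<bar>\<^sup>2) * exp (- a * x\<^sup>2)"
    using x by (intro mult_right_mono main) auto
  also have "\<dots> = gauss_sum a 0 * exp (9 / 10 * a * x\<^sup>2 + - a * x\<^sup>2)"
    by (simp only: exp_add power2_abs mult.assoc)
  also have "9 / 10 * a * x\<^sup>2 + - a * x\<^sup>2 = - (a / 10) * x\<^sup>2" by (simp add: field_simps)
  finally show ?thesis .
qed

section \<open>The theta transformation formula\<close>

text \<open>The real part of the characteristic function of the standard normal distribution, rescaled.\<close>
lemma gaussian_cosine_transform:
  fixes a s :: real
  assumes "0 < a"
  shows "((\<lambda>x. exp (- a * x\<^sup>2) * cos (s * x)) has_integral (sqrt (pi / a) * exp (- (s\<^sup>2 / (4 * a))))) UNIV"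
proof -
  \<comment> \<open>The substitution \<open>x \<mapsto> c x\<close> turns the standard normal density into a multiple of \<open>exp (- a x^2)\<close>.\<close>
  define c where "c = sqrt (2 * a)"
  have c: "0 < c" "c\<^sup>2 = 2 * a" using assms by (auto simp: c_def)
  define G where "G = (\<lambda>x. std_normal_density x * cos (s / c * x))"
  have intG: "integrable lborel G"
    unfolding G_def
  proof (rule Bochner_Integration.integrable_bound)
    show "integrable lborel std_normal_density" by (rule integrable_normal_density) simp
    show "AE x in lborel. norm (std_normal_density x * cos (s / c * x)) \<le> norm (std_normal_density x)"
      by (auto simp: abs_mult mult_left_le)
  qed simp
  interpret real_distribution std_normal_distribution by (rule real_dist_normal_dist)
  have "exp (- ((s / c)\<^sup>2) / 2) = Re (char std_normal_distribution (s / c))"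
    unfolding char_std_normal_distribution by simp
  also have "\<dots> = (LINT x|std_normal_distribution. Re (iexp (s / c * x)))"
    unfolding char_def by (intro integral_Re[symmetric] integrable_iexp) auto
  also have "\<dots> = (LINT x|std_normal_distribution. cos (s / c * x))"
    by (simp add: Re_exp)
  also have "\<dots> = integral\<^sup>L lborel G"
    unfolding G_def by (subst integral_density) auto
  also have "\<dots> = c * (\<integral>x. G (c * x) \<partial>lborel)"
    using lborel_integral_real_affine[of c G 0] c by simp
  also have "(\<lambda>x. G (c * x)) = (\<lambda>x. 1 / sqrt (2 * pi) * (exp (- a * x\<^sup>2) * cos (s * x)))"
    using c by (auto simp: G_def std_normal_density_def power_mult_distrib)
  finally have eq: "exp (- ((s / c)\<^sup>2) / 2)
      = c * (\<integral>x. 1 / sqrt (2 * pi) * (exp (- a * x\<^sup>2) * cos (s * x)) \<partial>lborel)" .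
  have "integrable lborel (\<lambda>x. G (0 + c * x))"
    using c by (intro lborel_integrable_real_affine intG) auto
  hence "integrable lborel (\<lambda>x. sqrt (2 * pi) * G (0 + c * x))" by simp
  also have "(\<lambda>x. sqrt (2 * pi) * G (0 + c * x)) = (\<lambda>x. exp (- a * x\<^sup>2) * cos (s * x))"
    using c by (auto simp: G_def std_normal_density_def power_mult_distrib)
  finally have int: "integrable lborel (\<lambda>x. exp (- a * x\<^sup>2) * cos (s * x))" .
  have "(\<integral>x. exp (- a * x\<^sup>2) * cos (s * x) \<partial>lborel) = sqrt (2 * pi) / c * exp (- ((s / c)\<^sup>2) / 2)"
    using eq c by (simp add: field_simps)
  also have "sqrt (2 * pi) / c = sqrt (pi / a)"
    using assms by (simp add: c_def flip: real_sqrt_divide)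
  also have "- ((s / c)\<^sup>2) / 2 = - (s\<^sup>2 / (4 * a))"
    using c by (simp add: power_divide)
  finally show ?thesis using has_integral_integral_lborel[OF int] by simp
qed

lemma integral_symmetric_tendsto:
  fixes G :: "real \<Rightarrow> real"
  assumes "(G has_integral I) UNIV"
  shows "(\<lambda>N. integral {- real N..real N} G) \<longlonglongrightarrow> I"
proof (rule LIMSEQ_I)
  fix e :: real assume "0 < e"
  then obtain B where B: "\<And>a b. ball 0 B \<subseteq> cbox a b \<Longrightarrow> norm (integral (cbox a b) G - I) < e"
    using assms unfolding has_integral_alt'[of G I UNIV] by fastforce
  obtain N0 where N0: "B \<le> real N0" using real_arch_simple by blast
  have "norm (integral {- real N..real N} G - I) < e" if "N0 \<le> N" for N
    using B[of "- real N" "real N"] N0 that by (fastforce simp: dist_norm)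
  thus "\<exists>N0. \<forall>N\<ge>N0. norm (integral {- real N..real N} G - I) < e" by blast
qed

lemma sum_unit_interval_integrals:
  fixes G :: "real \<Rightarrow> real"
  assumes "continuous_on UNIV G"
  shows "(\<Sum>n\<in>{1 - int N..int N}. integral {- of_int n..1 - of_int n} G) = integral {- real N..real N} G"
proof (induction N)
  case (Suc N)
  have int: "G integrable_on {u..v}" for u v
    using assms by (intro integrable_continuous_interval continuous_on_subset[OF assms]) auto
  have "{1 - int (Suc N)..int (Suc N)} = insert (- int N) (insert (int (Suc N)) {1 - int N..int N})"
    by auto
  hence "(\<Sum>n\<in>{1 - int (Suc N)..int (Suc N)}. integral {- of_int n..1 - of_int n} G)
    = integral {real N..1 + real N} G + (integral {- 1 - real N..- real N} G + integral {- real N..real N} G)"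
    using Suc by simp
  also have "integral {- 1 - real N..- real N} G + integral {- real N..real N} G = integral {- 1 - real N..real N} G"
    by (rule Henstock_Kurzweil_Integration.integral_combine) (auto intro: int)
  also have "integral {real N..1 + real N} G + \<dots> = integral {- 1 - real N..1 + real N} G"
    by (subst add.commute, rule Henstock_Kurzweil_Integration.integral_combine) (auto intro: int)
  finally show ?case by (simp add: algebra_simps)
qed simp

text \<open>The index sets run from \<open>1 - N\<close> to \<open>N\<close> because the intervals \<open>[-n, 1 - n]\<close> then tile \<open>[-N, N]\<close>.\<close>
lemma has_sum_imp_tendsto_symmetric:
  fixes f :: "int \<Rightarrow> real"
  assumes "(f has_sum S) UNIV"
  shows "(\<lambda>N. sum f {1 - int N..int N}) \<longlonglongrightarrow> S"
proof -
  have "filterlim (\<lambda>N. {1 - int N..int N}) (finite_subsets_at_top UNIV) sequentially"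
    unfolding filterlim_finite_subsets_at_top
  proof (intro allI impI)
    fix X :: "int set" assume "finite X \<and> X \<subseteq> UNIV"
    hence K: "\<bar>n\<bar> \<le> Max (abs ` X)" if "n \<in> X" for n using that by (intro Max_ge) auto
    have "finite {1 - int N..int N} \<and> X \<subseteq> {1 - int N..int N} \<and> {1 - int N..int N} \<subseteq> UNIV"
      if "nat (Max (abs ` X)) + 1 \<le> N" for N
      using that K by fastforce
    thus "\<forall>\<^sub>F N in sequentially. finite {1 - int N..int N} \<and> X \<subseteq> {1 - int N..int N} \<and> {1 - int N..int N} \<subseteq> UNIV"
      using eventually_sequentially by blast
  qed
  thus ?thesis using assms filterlim_compose unfolding has_sum_def by blast
qed

text \<open>By the Weierstrass M-test the partial sums over finite sets of integers converge uniformly, and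
uniform limits preserve continuity and integrals.\<close>
lemma dominated_infsum_continuous_integral:
  fixes f :: "int \<Rightarrow> real \<Rightarrow> real"
  assumes bound: "\<And>n x. x \<in> {0..1} \<Longrightarrow> \<bar>f n x\<bar> \<le> M n" and M: "M summable_on UNIV"
    and cont: "\<And>n. continuous_on {0..1} (f n)"
  shows "continuous_on {0..1} (\<lambda>x. \<Sum>\<^sub>\<infinity>n. f n x)"
    and "((\<lambda>n. integral {0..1} (f n)) has_sum integral {0..1} (\<lambda>x. \<Sum>\<^sub>\<infinity>n. f n x)) UNIV"
proof -
  have lim: "uniform_limit {0..1} (\<lambda>X x. \<Sum>n\<in>X. f n x) (\<lambda>x. \<Sum>\<^sub>\<infinity>n. f n x) (finite_subsets_at_top UNIV)"
    by (rule Weierstrass_m_test_general[OF _ M]) (use bound in auto)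
  have cs: "continuous_on {0..1} (\<lambda>x. \<Sum>n\<in>X. f n x)" for X
    by (intro continuous_on_sum cont)
  show "continuous_on {0..1} (\<lambda>x. \<Sum>\<^sub>\<infinity>n. f n x)"
    by (rule uniform_limit_theorem[OF _ lim]) (auto simp: cs)
  from uniform_limit_integral[OF lim cs]
  obtain I J where IJ: "\<And>X. ((\<lambda>x. \<Sum>n\<in>X. f n x) has_integral I X) {0..1}"
    "((\<lambda>x. \<Sum>\<^sub>\<infinity>n. f n x) has_integral J) {0..1}" "(I \<longlongrightarrow> J) (finite_subsets_at_top UNIV)"
    by auto
  have "I X = (\<Sum>n\<in>X. integral {0..1} (f n))" if "finite X" for X
    using integral_sum[OF that, of f "{0..1}"] integral_unique[OF IJ(1)[of X]] cont
    by (simp add: integrable_continuous_interval)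
  hence "eventually (\<lambda>X. I X = (\<Sum>n\<in>X. integral {0..1} (f n))) (finite_subsets_at_top UNIV)"
    by (intro eventually_finite_subsets_at_top_weakI) auto
  hence "((\<lambda>X. \<Sum>n\<in>X. integral {0..1} (f n)) \<longlongrightarrow> J) (finite_subsets_at_top UNIV)"
    using IJ(3) by (rule Lim_transform_eventually[rotated])
  thus "((\<lambda>n. integral {0..1} (f n)) has_sum integral {0..1} (\<lambda>x. \<Sum>\<^sub>\<infinity>n. f n x)) UNIV"
    using IJ(2) by (simp add: has_sum_def integral_unique)
qed

lemma cos_shift_int: "cos (2 * pi * real k * (x - of_int n)) = cos (2 * pi * real k * x)"
proof -
  have "cos (2 * pi * real k * (x - of_int n)) = cos (2 * pi * real k * x - 2 * pi * of_int (int k * n))"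
    by (simp add: algebra_simps)
  also have "\<dots> = cos (2 * pi * real k * x)"
    unfolding cos_diff cos_int_2pin sin_int_2pin by simp
  finally show ?thesis .
qed

text \<open>A majorant that does not depend on \<open>x\<close>: a lattice point \<open>n \<le> 0\<close> is at least as far from \<open>x\<close> as from
\<open>0\<close>, and any other at least as far from \<open>x\<close> as from \<open>1\<close>.\<close>
lemma gauss_term_le:
  fixes a x :: real
  assumes "0 < a" "x \<in> {0..1}"
  shows "exp (- a * (of_int n - x)\<^sup>2) \<le> exp (- a * (of_int n - 0)\<^sup>2) + exp (- a * (of_int n - 1)\<^sup>2)"
proof (cases "n \<le> 0")
  case True
  hence "real_of_int n \<le> 0" by simp
  hence "\<bar>real_of_int n - 0\<bar> \<le> \<bar>real_of_int n - x\<bar>" using assms by (auto simp: abs_if)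
  hence "exp (- a * (of_int n - x)\<^sup>2) \<le> exp (- a * (of_int n - 0)\<^sup>2)"
    using assms by (simp only: abs_le_square_iff) simp
  thus ?thesis by (simp add: add_increasing2)
next
  case False
  hence "1 \<le> real_of_int n" by simp
  hence "\<bar>real_of_int n - 1\<bar> \<le> \<bar>real_of_int n - x\<bar>" using assms by (auto simp: abs_if)
  hence "exp (- a * (of_int n - x)\<^sup>2) \<le> exp (- a * (of_int n - 1)\<^sup>2)"
    using assms by (simp only: abs_le_square_iff) simp
  thus ?thesis by (simp add: add_increasing)
qed

lemma gauss_majorant_summable:
  assumes "0 < (a::real)"
  shows "(\<lambda>n::int. exp (- a * (of_int n - 0)\<^sup>2) + exp (- a * (of_int n - 1)\<^sup>2)) summable_on UNIV"
  by (intro summable_on_add gauss_summable_on assms)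

lemma continuous_on_gauss_sum:
  assumes "0 < a" shows "continuous_on {0..1} (gauss_sum a)"
  unfolding gauss_sum_def using gauss_term_le[OF assms]
  by (intro dominated_infsum_continuous_integral(1)[OF _ gauss_majorant_summable[OF assms]]) (auto intro!: continuous_intros)

text \<open>Unfolding: the translates of \<open>[0, 1]\<close> by integers tile the line and the cosine is periodic, so
integrating the periodized Gaussian against it over one period gives the integral over the whole line.\<close>
lemma gauss_sum_cosine_coefficient:
  fixes a :: real and k :: nat
  assumes a: "0 < a"
  shows "integral {0..1} (\<lambda>x. gauss_sum a x * cos (2 * pi * real k * x))
    = sqrt (pi / a) * exp (- (pi\<^sup>2 / a) * (real k)\<^sup>2)"
proof -
  let ?f = "\<lambda>(n::int) x. exp (- a * (of_int n - x)\<^sup>2) * cos (2 * pi * real k * x)"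
  define G where "G = (\<lambda>x. exp (- a * x\<^sup>2) * cos (2 * pi * real k * x))"
  have "\<bar>?f n x\<bar> \<le> exp (- a * (of_int n - 0)\<^sup>2) + exp (- a * (of_int n - 1)\<^sup>2)" if "x \<in> {0..1}" for n x
  proof -
    have "\<bar>?f n x\<bar> \<le> exp (- a * (of_int n - x)\<^sup>2)" by (simp add: abs_mult mult_left_le)
    thus ?thesis using gauss_term_le[OF a that, of n] by linarith
  qed
  hence hs: "((\<lambda>n. integral {0..1} (?f n)) has_sum integral {0..1} (\<lambda>x. \<Sum>\<^sub>\<infinity>n. ?f n x)) UNIV"
    by (intro dominated_infsum_continuous_integral(2)[OF _ gauss_majorant_summable[OF a]]) (auto intro!: continuous_intros)
  have inf: "(\<lambda>x. \<Sum>\<^sub>\<infinity>n. ?f n x) = (\<lambda>x. gauss_sum a x * cos (2 * pi * real k * x))"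
    unfolding gauss_sum_def by (simp add: infsum_cmult_left')
  have shift: "integral {0..1} (?f n) = integral {- of_int n..1 - of_int n} G" for n
  proof -
    have "?f n = G \<circ> ((+) (- of_int n))"
      using cos_shift_int[of k _ n] by (auto simp: G_def power2_commute)
    thus ?thesis using integral_shift_Icc_real[of 0 1 G "- of_int n"] by simp
  qed
  have "(\<lambda>N. integral {- real N..real N} G) \<longlonglongrightarrow> integral {0..1} (\<lambda>x. gauss_sum a x * cos (2 * pi * real k * x))"
    using has_sum_imp_tendsto_symmetric[OF hs] unfolding shift inf
    by (subst (asm) sum_unit_interval_integrals) (auto simp: G_def intro!: continuous_intros)
  moreover have "(\<lambda>N. integral {- real N..real N} G) \<longlonglongrightarrow> sqrt (pi / a) * exp (- ((2 * pi * real k)\<^sup>2 / (4 * a)))"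
    unfolding G_def by (intro integral_symmetric_tendsto gaussian_cosine_transform a)
  ultimately have "integral {0..1} (\<lambda>x. gauss_sum a x * cos (2 * pi * real k * x))
      = sqrt (pi / a) * exp (- ((2 * pi * real k)\<^sup>2 / (4 * a)))"
    by (rule LIMSEQ_unique)
  thus ?thesis by (simp add: power_mult_distrib)
qed

lemma integral_cos_int:
  "integral {0..1} (\<lambda>x. cos (2 * pi * of_int m * x)) = (if m = 0 then 1 else 0)"
proof (cases "m = 0")
  case False
  have "((\<lambda>x. cos (2 * pi * of_int m * x)) has_integral
      (sin (2 * pi * of_int m * 1) / (2 * pi * of_int m) - sin (2 * pi * of_int m * 0) / (2 * pi * of_int m))) {0..1}"
    using False
    by (intro fundamental_theorem_of_calculus)
      (auto intro!: derivative_eq_intros simp flip: has_real_derivative_iff_has_vector_derivative)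
  hence "((\<lambda>x. cos (2 * pi * of_int m * x)) has_integral 0) {0..1}"
    using sin_int_2pin[of m] by simp
  thus ?thesis using False by (simp add: integral_unique)
qed simp

lemma integral_cos_cos_int:
  "integral {0..1} (\<lambda>x. cos (2 * pi * of_int n * x) * cos (2 * pi * of_int k * x))
    = ((if n = k then 1 else 0) + (if n = - k then 1 else 0)) / 2"
proof -
  have "(\<lambda>x. cos (2 * pi * of_int n * x) * cos (2 * pi * of_int k * x))
     = (\<lambda>x. (cos (2 * pi * of_int (n - k) * x) + cos (2 * pi * of_int (n + k) * x)) / 2)"
    unfolding cos_times_cos by (simp add: algebra_simps)
  moreover have "integral {0..1} (\<lambda>x. (cos (2 * pi * of_int (n - k) * x) + cos (2 * pi * of_int (n + k) * x)) / 2)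
    = ((if n - k = 0 then 1 else 0) + (if n + k = 0 then 1 else 0)) / 2"
    unfolding integral_divide
    by (subst Henstock_Kurzweil_Integration.integral_add)
      (auto simp only: integral_cos_int intro!: integrable_continuous_interval continuous_intros)
  ultimately show ?thesis by (simp add: eq_neg_iff_add_eq_0)
qed

text \<open>The reflection symmetry makes \<open>D\<close> a continuous function \<open>E\<close> of \<open>cos (2 \<pi> x)\<close>. Vanishing cosine
coefficients make \<open>D\<close> orthogonal to all polynomials in \<open>cos (2 \<pi> x)\<close>, and these approximate \<open>E\<close>
uniformly by the Weierstrass theorem; hence \<open>D\<close> is orthogonal to itself.\<close>
lemma cosine_coefficients_unique:
  fixes D :: "real \<Rightarrow> real"
  assumes cont: "continuous_on {0..1} D" and refl: "\<And>x. x \<in> {0..1} \<Longrightarrow> D (1 - x) = D x"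
    and coeff: "\<And>k::nat. integral {0..1} (\<lambda>x. D x * cos (2 * pi * real k * x)) = 0"
    and x: "x \<in> {0..1}"
  shows "D x = 0"
proof -
  let ?c = "\<lambda>x. cos (2 * pi * x)"
  have intg: "(\<lambda>x. D x * h x) integrable_on {0..1}" if "continuous_on {0..1} h" for h
    by (intro integrable_continuous_interval continuous_intros cont that)
  \<comment> \<open>One factor \<open>cos (2 \<pi> x)\<close> is traded for the two neighbouring frequencies by the product formula.\<close>
  have pow: "integral {0..1} (\<lambda>x. D x * (?c x ^ j * cos (2 * pi * real k * x))) = 0" for j k :: nat
  proof (induction j arbitrary: k)
    case (Suc j)
    show ?case
    proof (cases k)
      case 0
      thus ?thesis using Suc[of 1] by (simp add: mult_ac)
    next
      case (Suc m)
      let ?h = "\<lambda>k x. D x * (?c x ^ j * cos (2 * pi * real k * x))"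
      have "D x * (?c x ^ Suc j * cos (2 * pi * real k * x)) = (?h m x + ?h (Suc k) x) / 2" for x
      proof -
        have "?c x * cos (2 * pi * real k * x) = (cos (2 * pi * real m * x) + cos (2 * pi * real (Suc k) * x)) / 2"
          using cos_times_cos[of "2 * pi * real k * x" "2 * pi * x"] unfolding Suc
          by (simp add: algebra_simps)
        hence "D x * (?c x ^ j * (?c x * cos (2 * pi * real k * x)))
          = D x * (?c x ^ j * ((cos (2 * pi * real m * x) + cos (2 * pi * real (Suc k) * x)) / 2))"
          by (simp only:)
        thus ?thesis by (simp only: power_Suc2 mult.assoc distrib_left times_divide_eq_right)
      qed
      moreover have "integral {0..1} (\<lambda>x. (?h m x + ?h (Suc k) x) / 2) = 0"
        unfolding integral_divide
        by (subst Henstock_Kurzweil_Integration.integral_add)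
          (auto simp only: Suc.IH add_0_left div_0 intro!: intg continuous_intros)
      ultimately show ?thesis by (simp only:)
    qed
  qed (simp add: coeff)
  define E where "E y = D (arccos y / (2 * pi))" for y
  have contE: "continuous_on {-1..1} E"
    unfolding E_def
  proof (intro continuous_on_compose2[OF cont] continuous_intros image_subsetI)
    fix y :: real assume "y \<in> {-1..1}"
    hence "0 \<le> arccos y" "arccos y \<le> 2 * pi"
      using arccos_lbound[of y] arccos_ubound[of y] pi_ge_zero by auto
    thus "arccos y / (2 * pi) \<in> {0..1}" by simp
  qed auto
  \<comment> \<open>\<open>arccos\<close> inverts \<open>cos (2 \<pi> x)\<close> only on the left half of the period; the symmetry covers the right half.\<close>
  have E: "E (?c x) = D x" if "x \<in> {0..1}" for x
  proof (cases "x \<le> 1 / 2")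
    case True
    hence "arccos (?c x) = 2 * pi * x" using that by (intro arccos_cos) auto
    thus ?thesis by (simp add: E_def)
  next
    case False
    have "?c x = ?c (1 - x)" by (simp add: right_diff_distrib cos_diff)
    moreover have "arccos (?c (1 - x)) = 2 * pi * (1 - x)" using that False by (intro arccos_cos) auto
    ultimately show ?thesis using refl[OF that] by (simp add: E_def)
  qed
  define C where "C = integral {0..1} (\<lambda>x. \<bar>D x\<bar>)"
  have C: "0 \<le> C" unfolding C_def
    by (intro Henstock_Kurzweil_Integration.integral_nonneg integrable_continuous_interval continuous_intros cont) auto
  have sq: "integral {0..1} (\<lambda>x. D x * D x) \<le> e * C" if "0 < e" for e
  proof -
    obtain p where p: "real_polynomial_function p" "\<And>y. y \<in> {-1..1} \<Longrightarrow> \<bar>E y - p y\<bar> < e"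
      using Stone_Weierstrass_real_polynomial_function[of "{-1..1}" E e] contE \<open>0 < e\<close> by auto
    then obtain q n where q: "p = (\<lambda>y. \<Sum>i\<le>n. q i * y ^ i)"
      using real_polynomial_function_iff_sum by auto
    have "integral {0..1} (\<lambda>x. D x * p (?c x)) = (\<Sum>i\<le>n. integral {0..1} (\<lambda>x. q i * (D x * ?c x ^ i)))"
      unfolding q sum_distrib_left
      by (subst Henstock_Kurzweil_Integration.integral_sum[symmetric])
        (auto simp: mult_ac intro!: integrable_continuous_interval continuous_intros cont)
    also have "\<dots> = 0" using pow[of _ 0] by simp
    finally have p0: "integral {0..1} (\<lambda>x. D x * p (?c x)) = 0" .
    have contp: "continuous_on {0..1} (\<lambda>x. p (?c x))" unfolding q by (intro continuous_intros)
    have "integral {0..1} (\<lambda>x. D x * D x) = integral {0..1} (\<lambda>x. D x * D x) - integral {0..1} (\<lambda>x. D x * p (?c x))"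
      by (simp add: p0)
    also have "\<dots> = integral {0..1} (\<lambda>x. D x * D x - D x * p (?c x))"
      by (intro Henstock_Kurzweil_Integration.integral_diff[symmetric] intg cont contp)
    also have "\<dots> \<le> integral {0..1} (\<lambda>x. e * \<bar>D x\<bar>)"
    proof (intro integral_le integrable_continuous_interval continuous_intros cont contp)
      fix x :: real assume x: "x \<in> {0..1}"
      have "D x * D x - D x * p (?c x) = D x * (E (?c x) - p (?c x))" using E[OF x] by (simp add: algebra_simps)
      also have "\<dots> \<le> \<bar>D x\<bar> * \<bar>E (?c x) - p (?c x)\<bar>" by (metis abs_ge_self abs_mult)
      also have "\<dots> \<le> \<bar>D x\<bar> * e" by (intro mult_left_mono less_imp_le[OF p(2)]) auto
      finally show "D x * D x - D x * p (?c x) \<le> e * \<bar>D x\<bar>" by (simp add: mult.commute)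
    qed
    also have "\<dots> = e * C" by (simp add: C_def)
    finally show ?thesis .
  qed
  have "integral {0..1} (\<lambda>x. D x * D x) \<le> 0"
  proof (rule field_le_epsilon)
    fix e :: real assume e: "0 < e"
    \<comment> \<open>The summand \<open>1\<close> avoids dividing by zero when \<open>D\<close> vanishes identically.\<close>
    have "integral {0..1} (\<lambda>x. D x * D x) \<le> e / (C + 1) * C" using C e by (intro sq) auto
    also have "\<dots> \<le> 0 + e" using C e by (simp add: field_simps)
    finally show "integral {0..1} (\<lambda>x. D x * D x) \<le> 0 + e" .
  qed
  moreover have "0 \<le> integral {0..1} (\<lambda>x. D x * D x)"
    by (intro Henstock_Kurzweil_Integration.integral_nonneg intg cont) auto
  ultimately have "integral {0..1} (\<lambda>x. D x * D x) = 0" by simp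
  hence "D x * D x = 0"
    using integral_eq_0_iff[of 0 1 "\<lambda>x. D x * D x"] x by (simp add: continuous_on_mult cont)
  thus ?thesis by simp
qed

text \<open>Jacobi's transformation formula, the Poisson summation formula for the Gaussian. Both sides are
continuous, symmetric under \<open>x \<mapsto> 1 - x\<close> and have the same cosine coefficients.\<close>
lemma theta_transformation:
  fixes a x :: real
  assumes a: "0 < a" and x: "x \<in> {0..1}"
  shows "gauss_sum a x = sqrt (pi / a) * (\<Sum>\<^sub>\<infinity>n::int. exp (- (pi\<^sup>2 / a) * (of_int n)\<^sup>2) * cos (2 * pi * of_int n * x))"
proof -
  define b where "b = pi\<^sup>2 / a"
  have b: "0 < b" using a by (simp add: b_def)
  let ?g = "\<lambda>(n::int) x. exp (- b * (of_int n)\<^sup>2) * cos (2 * pi * of_int n * x)"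
  define g where "g x = (\<Sum>\<^sub>\<infinity>n. ?g n x)" for x
  have M: "(\<lambda>n::int. exp (- b * (of_int n)\<^sup>2)) summable_on UNIV"
    using gauss_summable_on[OF b, of 0] by simp
  have contg: "continuous_on {0..1} g" unfolding g_def
    by (intro dominated_infsum_continuous_integral(1)[OF _ M]) (auto simp: abs_mult mult_left_le intro!: continuous_intros)
  have reflg: "g (1 - x) = g x" for x
  proof -
    have "cos (2 * pi * of_int n * (1 - x)) = cos (2 * pi * of_int n * x)" for n :: int
      by (simp add: right_diff_distrib cos_diff)
    thus ?thesis by (simp add: g_def)
  qed
  have coeffg: "integral {0..1} (\<lambda>x. g x * cos (2 * pi * real k * x)) = exp (- b * (real k)\<^sup>2)" for k :: nat
  proof -
    let ?h = "\<lambda>(n::int) x. ?g n x * cos (2 * pi * real k * x)"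
    have bound: "\<bar>?h n x\<bar> \<le> exp (- b * (of_int n)\<^sup>2)" for n x
    proof -
      have "\<bar>cos (2 * pi * of_int n * x)\<bar> * \<bar>cos (2 * pi * real k * x)\<bar> \<le> 1 * 1"
        by (intro mult_mono) auto
      thus ?thesis by (simp add: abs_mult mult_left_le mult.assoc)
    qed
    have "((\<lambda>n. integral {0..1} (?h n)) has_sum integral {0..1} (\<lambda>x. \<Sum>\<^sub>\<infinity>n. ?h n x)) UNIV"
      by (rule dominated_infsum_continuous_integral(2)[OF bound M]) (auto intro!: continuous_intros)
    also have "(\<lambda>x. \<Sum>\<^sub>\<infinity>n. ?h n x) = (\<lambda>x. g x * cos (2 * pi * real k * x))"
      unfolding g_def by (simp add: infsum_cmult_left')
    finally have 1: "((\<lambda>n. integral {0..1} (?h n)) has_sum integral {0..1} (\<lambda>x. g x * cos (2 * pi * real k * x))) UNIV" .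
    have hn: "integral {0..1} (?h n) = exp (- b * (of_int n)\<^sup>2) * (((if n = int k then 1 else 0) + (if n = - int k then 1 else 0)) / 2)" for n
      using integral_cos_cos_int[of n "int k"] by (simp add: mult.assoc)
    let ?w = "\<lambda>n::int. exp (- b * (of_int n)\<^sup>2) * (((if n = int k then 1 else 0) + (if n = - int k then 1 else 0)) / 2)"
    have "(?w has_sum sum ?w {int k, - int k}) {int k, - int k}"
      by (rule has_sum_finite) simp
    hence 2: "(?w has_sum sum ?w {int k, - int k}) UNIV"
      by (rule has_sum_cong_neutral[THEN iffD1, rotated -1]) auto
    have "sum ?w {int k, - int k} = exp (- b * (real k)\<^sup>2)" by (cases "k = 0") auto
    thus ?thesis using has_sum_unique[OF 1[unfolded hn] 2] by simp
  qed
  define D where "D x = gauss_sum a x - sqrt (pi / a) * g x" for x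
  have "D x = 0"
  proof (rule cosine_coefficients_unique[OF _ _ _ x])
    show "continuous_on {0..1} D" unfolding D_def
      by (intro continuous_intros continuous_on_gauss_sum a contg)
    show "D (1 - x) = D x" for x by (simp add: D_def reflg gauss_sum_reflect)
    fix k :: nat
    have "integral {0..1} (\<lambda>x. D x * cos (2 * pi * real k * x))
      = integral {0..1} (\<lambda>x. gauss_sum a x * cos (2 * pi * real k * x) - sqrt (pi / a) * (g x * cos (2 * pi * real k * x)))"
      by (simp add: D_def algebra_simps)
    also have "\<dots> = integral {0..1} (\<lambda>x. gauss_sum a x * cos (2 * pi * real k * x))
       - integral {0..1} (\<lambda>x. sqrt (pi / a) * (g x * cos (2 * pi * real k * x)))"
      by (intro Henstock_Kurzweil_Integration.integral_diff integrable_continuous_interval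
          continuous_intros continuous_on_gauss_sum a contg)
    also have "\<dots> = 0"
      by (simp add: gauss_sum_cosine_coefficient[OF a] coeffg b_def)
    finally show "integral {0..1} (\<lambda>x. D x * cos (2 * pi * real k * x)) = 0" .
  qed
  thus ?thesis by (simp add: D_def g_def b_def)
qed

section \<open>Bounds at long times\<close>

definition cos_sum :: "real \<Rightarrow> real \<Rightarrow> real" where
  "cos_sum b x = 1 + 2 * (\<Sum>n. exp (- b * (real (Suc n))\<^sup>2) * cos (2 * pi * real (Suc n) * x))"

lemma summable_exp_square:
  fixes b :: real
  assumes "0 < b"
  shows "summable (\<lambda>n. exp (- b * (real (Suc n))\<^sup>2))"
  using summable_gauss_cosh[OF assms, of 0] by simp

lemma summable_cos_sum:
  fixes b x :: real
  assumes "0 < b"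
  shows "summable (\<lambda>n. exp (- b * (real (Suc n))\<^sup>2) * cos (2 * pi * real (Suc n) * x))"
  by (rule summable_comparison_test'[OF summable_exp_square[OF assms], of 0])
    (simp add: abs_mult mult_left_le)

lemma gauss_sum_eq_cos_sum:
  fixes a x :: real
  assumes a: "0 < a" and x: "x \<in> {0..1}"
  shows "gauss_sum a x = sqrt (pi / a) * cos_sum (pi\<^sup>2 / a) x"
proof -
  define b where "b = pi\<^sup>2 / a"
  have b: "0 < b" using a by (simp add: b_def)
  let ?g = "\<lambda>n::int. exp (- b * (of_int n)\<^sup>2) * cos (2 * pi * of_int n * x)"
  have "(\<lambda>n::int. exp (- b * (of_int n)\<^sup>2)) summable_on UNIV"
    using gauss_summable_on[OF b, of 0] by simp
  hence "(\<lambda>n. norm (?g n)) summable_on UNIV"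
    by (rule Infinite_Sum.abs_summable_on_comparison_test') (simp add: abs_mult mult_left_le)
  hence "?g summable_on UNIV" by (rule abs_summable_summable)
  from int_sums_of_has_sum[OF has_sum_infsum[OF this]]
  have "(\<lambda>n. ?g (int (Suc n)) + ?g (- int (Suc n))) sums (infsum ?g UNIV - 1)" by simp
  also have "(\<lambda>n. ?g (int (Suc n)) + ?g (- int (Suc n)))
      = (\<lambda>n. 2 * (exp (- b * (real (Suc n))\<^sup>2) * cos (2 * pi * real (Suc n) * x)))"
    by (simp only: of_int_minus of_int_of_nat_eq power2_minus mult_minus_left mult_minus_right cos_minus mult_2)
  finally have "(\<lambda>n. 2 * (exp (- b * (real (Suc n))\<^sup>2) * cos (2 * pi * real (Suc n) * x))) sums (infsum ?g UNIV - 1)" .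
  hence "(\<Sum>n. 2 * (exp (- b * (real (Suc n))\<^sup>2) * cos (2 * pi * real (Suc n) * x))) = infsum ?g UNIV - 1"
    by (rule sums_unique[symmetric])
  hence "cos_sum b x = infsum ?g UNIV"
    unfolding suminf_mult[OF summable_cos_sum[OF b]] cos_sum_def by simp
  thus ?thesis using theta_transformation[OF a x] by (simp add: b_def)
qed

lemma one_minus_cos_le: "1 - cos (2 * pi * m * x) \<le> 2 * pi\<^sup>2 * x\<^sup>2 * m\<^sup>2"
proof -
  have "1 - cos (2 * pi * m * x) = 2 * (sin (pi * m * x))\<^sup>2"
    using cos_double_sin[of "pi * m * x"] by (simp add: mult.assoc)
  also have "\<dots> \<le> 2 * (pi * m * x)\<^sup>2"
    using abs_sin_x_le_abs_x[of "pi * m * x"] by (simp add: abs_le_square_iff)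
  finally show ?thesis by (simp add: power_mult_distrib algebra_simps)
qed

text \<open>Jordan's inequality: the concave function \<open>sin\<close> lies above its chord on \<open>[0, \<pi>/2]\<close>.\<close>
lemma sin_pi_ge:
  fixes x :: real
  assumes "0 \<le> x" "x \<le> 1 / 2"
  shows "2 * x \<le> sin (pi * x)"
proof -
  have conc: "concave_on {0..pi / 2} sin"
    by (rule f''_le0_imp_concave[where f' = cos and f'' = "\<lambda>x. - sin x"])
      (auto intro!: derivative_eq_intros sin_ge_zero)
  have "(1 - 2 * x) * sin 0 + 2 * x * sin (pi / 2) \<le> sin ((1 - 2 * x) *\<^sub>R 0 + (2 * x) *\<^sub>R (pi / 2))"
    using assms by (intro concave_onD[OF conc]) auto
  thus ?thesis by (simp add: mult.commute)
qed

lemma one_minus_cos_ge: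
  assumes "\<bar>x\<bar> \<le> 1 / 2"
  shows "8 * x\<^sup>2 \<le> 1 - cos (2 * pi * x)"
proof -
  have "(2 * \<bar>x\<bar>)\<^sup>2 \<le> (sin (pi * \<bar>x\<bar>))\<^sup>2"
    using assms by (intro power_mono sin_pi_ge) auto
  moreover have "1 - cos (2 * pi * \<bar>x\<bar>) = 2 * (sin (pi * \<bar>x\<bar>))\<^sup>2"
    using cos_double_sin[of "pi * \<bar>x\<bar>"] by (simp add: mult.assoc)
  moreover have "cos (2 * pi * \<bar>x\<bar>) = cos (2 * pi * x)" by (simp add: abs_if)
  ultimately show ?thesis by (simp add: power_mult_distrib)
qed

lemma cos_sum_diff:
  assumes "0 < b"
  shows "summable (\<lambda>n. exp (- b * (real (Suc n))\<^sup>2) * (1 - cos (2 * pi * real (Suc n) * x)))"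
    and "cos_sum b 0 - cos_sum b x
    = 2 * (\<Sum>n. exp (- b * (real (Suc n))\<^sup>2) * (1 - cos (2 * pi * real (Suc n) * x)))"
proof -
  note s = summable_exp_square[OF assms] summable_cos_sum[OF assms, of x]
  show "summable (\<lambda>n. exp (- b * (real (Suc n))\<^sup>2) * (1 - cos (2 * pi * real (Suc n) * x)))"
    using summable_diff[OF s] by (simp add: right_diff_distrib)
  show "cos_sum b 0 - cos_sum b x
    = 2 * (\<Sum>n. exp (- b * (real (Suc n))\<^sup>2) * (1 - cos (2 * pi * real (Suc n) * x)))"
    using suminf_diff[OF s] by (simp add: cos_sum_def right_diff_distrib)
qed

text \<open>This is where the constant \<open>1 + 4 \<surd>2\<close> enters. With \<open>q = e^{-b} \<le> 64/73\<close> and \<open>n^2 \<ge> 3 n - 2\<close>, the sum of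
\<open>q^{n^2}\<close> over \<open>n \<ge> 1\<close> is at most \<open>q / (1 - q^3) \<le> 2.7 < 2 \<surd>2\<close>. The parameter \<open>9/64\<close> lies just below
\<open>4 \<pi>^2 t\<close> at the threshold \<open>t = 1/256\<close>.\<close>
lemma cos_sum_zero_le:
  assumes "9 / 64 \<le> b"
  shows "cos_sum b 0 \<le> 1 + 4 * sqrt 2"
proof -
  define q where "q = exp (- b)"
  have "1 + 9 / 64 \<le> exp b" using exp_ge_add_one_self[of b] assms by linarith
  hence q: "0 < q" "q \<le> 64 / 73" by (auto simp: q_def exp_minus field_simps)
  have q3: "q ^ 3 \<le> (64 / 73) ^ 3" using q by (intro power_mono) auto
  have le: "exp (- b * (real (Suc n))\<^sup>2) \<le> q * (q ^ 3) ^ n" for n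
  proof -
    have "real n \<le> real n * real n" by (cases n) auto
    hence "b * (1 + 3 * real n) \<le> b * (real (Suc n))\<^sup>2"
      using assms by (intro mult_left_mono) (auto simp: power2_eq_square algebra_simps)
    hence "exp (- b * (real (Suc n))\<^sup>2) \<le> exp (- b + real (3 * n) * (- b))"
      by (simp add: algebra_simps)
    also have "\<dots> = q * (q ^ 3) ^ n"
      unfolding exp_add q_def power_mult[symmetric] by (simp only: exp_of_nat_mult)
    finally show ?thesis .
  qed
  have g: "(\<lambda>n. q * (q ^ 3) ^ n) sums (q * (1 / (1 - q ^ 3)))"
    using q q3 by (intro sums_mult geometric_sums) (auto simp: power3_eq_cube)
  have "(\<Sum>n. exp (- b * (real (Suc n))\<^sup>2)) \<le> q * (1 / (1 - q ^ 3))"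
    using suminf_le[OF le summable_exp_square sums_summable[OF g]] sums_unique[OF g] assms by simp
  also have "\<dots> \<le> (64 / 73) * (1 / (1 - (64 / 73) ^ 3))"
    using q q3 by (intro mult_mono frac_le) (auto simp: power3_eq_cube)
  also have "\<dots> \<le> 2 * (7 / 5)" by (simp add: power3_eq_cube)
  also have "7 / 5 \<le> sqrt 2" by (rule real_le_rsqrt) (simp add: power2_eq_square)
  finally show ?thesis by (simp add: cos_sum_def)
qed

text \<open>All terms of \<open>cos_sum b 0 - cos_sum b x\<close> are nonnegative, and the first one alone gives the loss
\<open>16 e^{-b} x^2\<close>. Dividing by \<open>cos_sum b 0 \<le> 1 + 4 \<surd>2\<close> gives the exponent.\<close>
lemma cos_sum_le:
  assumes b: "9 / 64 \<le> b" and x: "\<bar>x\<bar> \<le> 1 / 2"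
  shows "cos_sum b x \<le> cos_sum b 0 * exp (- (16 / (1 + 4 * sqrt 2)) * exp (- b) * x\<^sup>2)"
proof -
  have b0: "0 < b" using b by simp
  let ?d = "\<lambda>n. exp (- b * (real (Suc n))\<^sup>2) * (1 - cos (2 * pi * real (Suc n) * x))"
  have "exp (- b) * (8 * x\<^sup>2) \<le> exp (- b) * (1 - cos (2 * pi * x))"
    using one_minus_cos_ge[OF x] by (intro mult_left_mono) auto
  also have "\<dots> = sum ?d {0}" by simp
  also have "\<dots> \<le> suminf ?d" by (intro sum_le_suminf cos_sum_diff b0) auto
  finally have d: "16 * exp (- b) * x\<^sup>2 \<le> cos_sum b 0 - cos_sum b x"
    unfolding cos_sum_diff(2)[OF b0] by simp
  have s: "0 < 1 + 4 * sqrt (2::real)" by (simp add: add_pos_pos)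
  define K where "K = 16 / (1 + 4 * sqrt 2) * exp (- b) * x\<^sup>2"
  have "cos_sum b 0 * K \<le> (1 + 4 * sqrt 2) * K"
    using s by (intro mult_right_mono cos_sum_zero_le b) (auto simp: K_def)
  also have "\<dots> = 16 * exp (- b) * x\<^sup>2" using s by (simp add: K_def)
  also have "\<dots> \<le> cos_sum b 0 - cos_sum b x" by (rule d)
  finally have "cos_sum b x \<le> cos_sum b 0 * (1 + - K)" by (simp add: algebra_simps)
  also have "\<dots> \<le> cos_sum b 0 * exp (- K)"
  proof (intro mult_left_mono exp_ge_add_one_self)
    show "0 \<le> cos_sum b 0"
      using suminf_nonneg[OF summable_exp_square[OF b0]] by (simp add: cos_sum_def)
  qed
  finally show ?thesis by (simp add: K_def)
qed

text \<open>Here \<open>e^{-b} \<le> 1/16\<close>, so \<open>cos_sum\<close> stays above \<open>1/2\<close>. By \<open>1 - cos y \<le> y^2 / 2\<close> and the second moment bound,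
\<open>cos_sum b 0 - cos_sum b x \<le> 64 e^{-b} x^2\<close>; the quotient therefore costs at most \<open>128 e^{-b} x^2\<close> in the
exponent.\<close>
lemma cos_sum_ge:
  assumes b: "4 \<le> b"
  shows "cos_sum b 0 * exp (- 128 * exp (- b) * x\<^sup>2) \<le> cos_sum b x"
proof -
  have b0: "0 < b" using b by simp
  define q where "q = exp (- b)"
  have q: "0 < q" "q \<le> 1 / 16" unfolding q_def using exp_minus_le_sixteenth[OF b] by auto
  let ?d = "\<lambda>n. exp (- b * (real (Suc n))\<^sup>2) * (1 - cos (2 * pi * real (Suc n) * x))"
  let ?m = "\<lambda>n. (real (Suc n))\<^sup>2 * exp (- b * (real (Suc n))\<^sup>2)"
  have "?d n \<le> 2 * pi\<^sup>2 * x\<^sup>2 * ?m n" for n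
    using mult_left_mono[OF one_minus_cos_le[of "real (Suc n)" x], of "exp (- b * (real (Suc n))\<^sup>2)"]
    by (simp only: mult_ac exp_ge_zero)
  hence "suminf ?d \<le> (\<Sum>n. 2 * pi\<^sup>2 * x\<^sup>2 * ?m n)"
    by (intro suminf_le cos_sum_diff b0 summable_mult gauss_second_moment_le b)
  also have "\<dots> = 2 * pi\<^sup>2 * x\<^sup>2 * suminf ?m" by (intro suminf_mult gauss_second_moment_le b)
  also have "\<dots> \<le> 2 * 12 * x\<^sup>2 * (4 / 3 * q)"
  proof (intro mult_mono)
    have "pi * pi \<le> 22 / 7 * (22 / 7)" using pi_approx by (intro mult_mono) auto
    thus "pi\<^sup>2 \<le> 12" by (simp add: power2_eq_square)
    show "suminf ?m \<le> 4 / 3 * q" unfolding q_def by (rule gauss_second_moment_le(2)[OF b])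
    show "0 \<le> suminf ?m" by (intro suminf_nonneg gauss_second_moment_le b) auto
  qed auto
  finally have d: "cos_sum b 0 - cos_sum b x \<le> 64 * q * x\<^sup>2"
    unfolding cos_sum_diff(2)[OF b0] by simp
  have low: "1 / 2 \<le> cos_sum b x"
  proof -
    have le: "- ?m n \<le> exp (- b * (real (Suc n))\<^sup>2) * cos (2 * pi * real (Suc n) * x)" for n
    proof -
      have "1 * exp (- b * (real (Suc n))\<^sup>2) \<le> ?m n"
        by (intro mult_right_mono) (auto simp: one_le_power)
      moreover have "exp (- b * (real (Suc n))\<^sup>2) * - 1 \<le> exp (- b * (real (Suc n))\<^sup>2) * cos (2 * pi * real (Suc n) * x)"
        by (intro mult_left_mono) auto
      ultimately show ?thesis by linarith
    qed
    have "- suminf ?m = (\<Sum>n. - ?m n)" by (intro suminf_minus[symmetric] gauss_second_moment_le b)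
    also have "\<dots> \<le> (\<Sum>n. exp (- b * (real (Suc n))\<^sup>2) * cos (2 * pi * real (Suc n) * x))"
      by (intro suminf_le le summable_cos_sum b0 summable_minus gauss_second_moment_le b)
    finally show ?thesis
      using gauss_second_moment_le(2)[OF b] q unfolding q_def cos_sum_def by simp
  qed
  have "cos_sum b 0 \<le> cos_sum b x + 1 / 2 * (128 * q * x\<^sup>2)" using d by simp
  also have "\<dots> \<le> cos_sum b x + cos_sum b x * (128 * q * x\<^sup>2)"
    using low q by (intro add_left_mono mult_right_mono) auto
  also have "\<dots> = cos_sum b x * (1 + 128 * q * x\<^sup>2)" by (simp add: algebra_simps)
  also have "\<dots> \<le> cos_sum b x * exp (128 * q * x\<^sup>2)"
    using low by (intro mult_left_mono exp_ge_add_one_self) auto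
  finally show ?thesis by (simp add: q_def exp_minus field_simps)
qed

lemma gauss_sum_eq_cos_sum_time:
  fixes t x :: real
  assumes t: "0 < t" and x: "\<bar>x\<bar> \<le> 1 / 2"
  shows "gauss_sum (1 / (4 * t)) x = sqrt (4 * pi * t) * cos_sum (4 * pi\<^sup>2 * t) x"
proof -
  have "cos (2 * pi * m * \<bar>x\<bar>) = cos (2 * pi * m * x)" for m by (simp add: abs_if)
  hence "cos_sum (4 * pi\<^sup>2 * t) \<bar>x\<bar> = cos_sum (4 * pi\<^sup>2 * t) x" by (simp only: cos_sum_def)
  thus ?thesis
    using gauss_sum_eq_cos_sum[of "1 / (4 * t)" "\<bar>x\<bar>"] t x
    by (simp add: gauss_sum_abs mult_ac)
qed

lemma gauss_sum_le_large_time: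
  fixes t x :: real
  assumes t: "1 / 256 \<le> t" and x: "\<bar>x\<bar> \<le> 1 / 2"
  shows "gauss_sum (1 / (4 * t)) x \<le> gauss_sum (1 / (4 * t)) 0
    * exp (- (16 / (1 + 4 * sqrt 2)) * exp (- 4 * pi\<^sup>2 * t) * x\<^sup>2)"
proof -
  have t0: "0 < t" using t by simp
  have "3 * 3 \<le> pi * pi" using pi_gt3 by (intro mult_mono) auto
  hence "4 * 9 * (1 / 256) \<le> 4 * pi\<^sup>2 * t" using t by (intro mult_mono) (auto simp: power2_eq_square)
  hence "cos_sum (4 * pi\<^sup>2 * t) x \<le> cos_sum (4 * pi\<^sup>2 * t) 0
      * exp (- (16 / (1 + 4 * sqrt 2)) * exp (- (4 * pi\<^sup>2 * t)) * x\<^sup>2)"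
    using x by (intro cos_sum_le) auto
  from mult_left_mono[OF this, of "sqrt (4 * pi * t)"] show ?thesis
    using t0 x by (simp add: gauss_sum_eq_cos_sum_time mult.assoc)
qed

text \<open>The constant in the exponent is so large that it need not be met by one argument over the whole
range. For \<open>t \<le> 1/8\<close> the exponent \<open>x^2 / (4 t) \<le> 64 x^2\<close> of the elementary lower bound is already better,
because \<open>e^{-4 \<pi>^2 t} \<ge> 3^{-5}\<close>; for \<open>t \<ge> 1/8\<close> the cosine sum is dominated by its first terms.\<close>
lemma gauss_sum_ge_large_time:
  fixes t x :: real
  assumes t: "1 / 256 \<le> t" and x: "\<bar>x\<bar> \<le> 1 / 2"
  shows "gauss_sum (1 / (4 * t)) 0
      * exp (- 256 * (pi ^ 3 + 1024 * pi * exp (- pi / 64)) * exp (- 4 * pi\<^sup>2 * t) * x\<^sup>2)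
    \<le> gauss_sum (1 / (4 * t)) x"
proof -
  have t0: "0 < t" using t by simp
  define C where "C = 256 * (pi ^ 3 + 1024 * pi * exp (- pi / 64))"
  have C: "256 * 1024 * 3 * (1 / 2) \<le> C"
  proof -
    have "1 / 2 \<le> exp (- pi / 64)" using exp_ge_add_one_self[of "- pi / 64"] pi_less_4 by simp
    hence "1024 * 3 * (1 / 2) \<le> 1024 * pi * exp (- pi / 64)"
      using pi_gt3 by (intro mult_mono) auto
    moreover have "0 \<le> pi ^ 3" by simp
    ultimately have "1024 * 3 * (1 / 2) \<le> pi ^ 3 + 1024 * pi * exp (- pi / 64)" by linarith
    hence "256 * (1024 * 3 * (1 / 2)) \<le> C" unfolding C_def by (intro mult_left_mono) auto
    thus ?thesis by simp
  qed
  have pos: "0 < gauss_sum (1 / (4 * t)) 0" using gauss_sum_ge_one[of "1 / (4 * t)"] t0 by simp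
  have "gauss_sum (1 / (4 * t)) 0 * exp (- C * exp (- 4 * pi\<^sup>2 * t) * x\<^sup>2) \<le> gauss_sum (1 / (4 * t)) x"
  proof (cases "t \<le> 1 / 8")
    case True
    have "pi * pi \<le> 22 / 7 * (22 / 7)" using pi_approx by (intro mult_mono) auto
    hence "4 * pi\<^sup>2 * t \<le> 4 * 10 * (1 / 8)"
      using True t0 by (intro mult_mono) (auto simp: power2_eq_square)
    hence "exp (4 * pi\<^sup>2 * t) \<le> exp (real 5 * 1)" by simp
    also have "\<dots> = exp 1 ^ 5" by (rule exp_of_nat_mult)
    also have "\<dots> \<le> 3 ^ 5" by (intro power_mono exp_le) auto
    finally have e: "1 / 243 \<le> exp (- 4 * pi\<^sup>2 * t)" by (simp add: exp_minus field_simps)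
    have "1 / (4 * t) \<le> 64" using t t0 by (simp add: field_simps)
    also have "64 \<le> 256 * 1024 * 3 * (1 / 2) * (1 / 243 :: real)" by simp
    also have "\<dots> \<le> C * exp (- 4 * pi\<^sup>2 * t)" using C e by (intro mult_mono) auto
    finally have "1 / (4 * t) * x\<^sup>2 \<le> C * exp (- 4 * pi\<^sup>2 * t) * x\<^sup>2"
      by (intro mult_right_mono) auto
    hence "exp (- C * exp (- 4 * pi\<^sup>2 * t) * x\<^sup>2) \<le> exp (- (1 / (4 * t)) * x\<^sup>2)" by simp
    hence "gauss_sum (1 / (4 * t)) 0 * exp (- C * exp (- 4 * pi\<^sup>2 * t) * x\<^sup>2)
        \<le> gauss_sum (1 / (4 * t)) 0 * exp (- (1 / (4 * t)) * x\<^sup>2)"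
      using pos by (intro mult_left_mono) auto
    also have "\<dots> \<le> gauss_sum (1 / (4 * t)) x" using t0 by (intro gauss_sum_ge) auto
    finally show ?thesis .
  next
    case False
    have "3 * 3 \<le> pi * pi" using pi_gt3 by (intro mult_mono) auto
    hence "4 * 9 * (1 / 8) \<le> 4 * pi\<^sup>2 * t" using False by (intro mult_mono) (auto simp: power2_eq_square)
    hence "cos_sum (4 * pi\<^sup>2 * t) 0 * exp (- 128 * exp (- (4 * pi\<^sup>2 * t)) * x\<^sup>2) \<le> cos_sum (4 * pi\<^sup>2 * t) x"
      by (intro cos_sum_ge) auto
    from mult_left_mono[OF this, of "sqrt (4 * pi * t)"]
    have ge: "gauss_sum (1 / (4 * t)) 0 * exp (- 128 * exp (- 4 * pi\<^sup>2 * t) * x\<^sup>2) \<le> gauss_sum (1 / (4 * t)) x"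
      using t0 x by (simp add: gauss_sum_eq_cos_sum_time mult.assoc)
    have "128 * exp (- 4 * pi\<^sup>2 * t) * x\<^sup>2 \<le> C * exp (- 4 * pi\<^sup>2 * t) * x\<^sup>2"
      using C by (intro mult_right_mono) auto
    hence "gauss_sum (1 / (4 * t)) 0 * exp (- C * exp (- 4 * pi\<^sup>2 * t) * x\<^sup>2)
        \<le> gauss_sum (1 / (4 * t)) 0 * exp (- 128 * exp (- 4 * pi\<^sup>2 * t) * x\<^sup>2)"
      using pos by (intro mult_left_mono) auto
    thus ?thesis using ge by linarith
  qed
  thus ?thesis by (simp add: C_def)
qed

section \<open>The heat kernel as a product over coordinates\<close>

text \<open>The Gaussian factors over the coordinates and the lattice is a product of copies of the integers.\<close>
lemma heat_kernel_eq_prod: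
  fixes \<xi> :: "real ^ 'n"
  assumes t: "0 < t"
  shows "heat_kernel t \<xi> = (4 * pi * t) powr (- real CARD('n) / 2) * (\<Prod>i\<in>UNIV. gauss_sum (1 / (4 * t)) (\<xi> $ i))"
proof -
  define h where "h = (\<lambda>m :: 'n \<Rightarrow> int. (\<chi> i. real_of_int (m i)))"
  have inj: "inj_on h A" for A by (auto simp: inj_on_def h_def vec_eq_iff)
  have lat: "int_lattice = h ` (PiE UNIV (\<lambda>_. UNIV))"
  proof -
    have "n \<in> range h" if "n \<in> int_lattice" for n :: "real ^ 'n"
    proof -
      from that have "\<forall>i. \<exists>m. n $ i = real_of_int m" by (auto simp: int_lattice_def Ints_def)
      then obtain m where "\<And>i. n $ i = real_of_int (m i)" by metis
      hence "n = h m" by (simp add: h_def vec_eq_iff)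
      thus ?thesis by blast
    qed
    thus ?thesis by (auto simp: int_lattice_def h_def)
  qed
  have summand: "exp (- (norm (h m - \<xi>))\<^sup>2 / (4 * t))
      = (\<Prod>i\<in>UNIV. exp (- (1 / (4 * t)) * (of_int (m i) - \<xi> $ i)\<^sup>2))" for m
  proof -
    have "(norm (h m - \<xi>))\<^sup>2 = (\<Sum>i\<in>UNIV. (of_int (m i) - \<xi> $ i)\<^sup>2)"
      by (simp add: norm_vec_def L2_set_def h_def sum_nonneg)
    thus ?thesis by (simp add: sum_divide_distrib exp_sum flip: sum_negf)
  qed
  have "infsum (\<lambda>n. exp (- (norm (n - \<xi>))\<^sup>2 / (4 * t))) int_lattice
     = infsum (\<lambda>m. \<Prod>i\<in>UNIV. exp (- (1 / (4 * t)) * (of_int (m i) - \<xi> $ i)\<^sup>2)) (PiE UNIV (\<lambda>_. UNIV))"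
    unfolding lat by (subst infsum_reindex[OF inj]) (simp only: o_def summand)
  also have "\<dots> = (\<Prod>i\<in>UNIV. gauss_sum (1 / (4 * t)) (\<xi> $ i))"
    unfolding gauss_sum_def using t gauss_summable_on[of "1 / (4 * t)"]
    by (intro infsum_prod_PiE_abs) auto
  finally show ?thesis by (simp add: heat_kernel_def)
qed

lemma exp_norm_eq_prod:
  fixes \<xi> :: "real ^ 'n"
  shows "exp (c * (norm \<xi>)\<^sup>2) = (\<Prod>i\<in>UNIV. exp (c * (\<xi> $ i)\<^sup>2))"
  by (simp add: norm_vec_def L2_set_def sum_nonneg exp_sum sum_distrib_left)

lemma torus_component_le:
  assumes "\<xi> \<in> torus"
  shows "\<bar>\<xi> $ i\<bar> \<le> 1 / 2"
proof -
  have "- 1 / 2 \<le> \<xi> $ i \<and> \<xi> $ i < 1 / 2" using assms unfolding torus_def by blast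
  thus ?thesis by (auto simp: abs_le_iff)
qed

text \<open>Bounds of the form \<open>e^{c x^2}\<close> multiply over the coordinates to \<open>e^{c |\<xi>|^2}\<close>. Hence no constant depends
on the dimension, and the torus estimates are exactly those of the circle.\<close>
lemma heat_kernel_le:
  fixes \<xi> :: "real ^ 'n"
  assumes t: "0 < t" and \<xi>: "\<xi> \<in> torus"
    and le: "\<And>x. \<bar>x\<bar> \<le> 1 / 2 \<Longrightarrow> gauss_sum (1 / (4 * t)) x \<le> gauss_sum (1 / (4 * t)) 0 * exp (c * x\<^sup>2)"
  shows "heat_kernel t \<xi> \<le> heat_kernel t (0 :: real ^ 'n) * exp (c * (norm \<xi>)\<^sup>2)"
proof -
  have "(\<Prod>i\<in>UNIV. gauss_sum (1 / (4 * t)) (\<xi> $ i))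
      \<le> (\<Prod>i\<in>UNIV. gauss_sum (1 / (4 * t)) 0 * exp (c * (\<xi> $ i)\<^sup>2))"
    by (intro prod_mono conjI le torus_component_le \<xi>) (auto simp: gauss_sum_nonneg)
  thus ?thesis using t
    by (simp add: heat_kernel_eq_prod exp_norm_eq_prod prod.distrib mult.assoc mult_left_mono)
qed

lemma heat_kernel_ge:
  fixes \<xi> :: "real ^ 'n"
  assumes t: "0 < t" and \<xi>: "\<xi> \<in> torus"
    and le: "\<And>x. \<bar>x\<bar> \<le> 1 / 2 \<Longrightarrow> gauss_sum (1 / (4 * t)) 0 * exp (c * x\<^sup>2) \<le> gauss_sum (1 / (4 * t)) x"
  shows "heat_kernel t (0 :: real ^ 'n) * exp (c * (norm \<xi>)\<^sup>2) \<le> heat_kernel t \<xi>"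
proof -
  have "(\<Prod>i\<in>UNIV. gauss_sum (1 / (4 * t)) 0 * exp (c * (\<xi> $ i)\<^sup>2))
      \<le> (\<Prod>i\<in>UNIV. gauss_sum (1 / (4 * t)) (\<xi> $ i))"
    by (intro prod_mono conjI le torus_component_le \<xi>) (auto simp: gauss_sum_nonneg)
  thus ?thesis using t
    by (simp add: heat_kernel_eq_prod exp_norm_eq_prod prod.distrib mult.assoc mult_left_mono)
qed

theorem proposition1p1:
  "(\<forall>t. 0 < t \<and> t < 1 / 2 ^ 8 \<longrightarrow> (\<forall>\<xi> \<in> (torus :: (real ^ 'n) set).
      heat_kernel t (0 :: real ^ 'n) * exp (- (norm \<xi>)\<^sup>2 / (4 * t)) \<le> heat_kernel t \<xi> \<and>
      heat_kernel t \<xi> \<le> heat_kernel t (0 :: real ^ 'n) * exp (- (norm \<xi>)\<^sup>2 / (40 * t)))) \<and>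
   (\<forall>t. t \<ge> 1 / 2 ^ 8 \<longrightarrow> (\<forall>\<xi> \<in> (torus :: (real ^ 'n) set).
      heat_kernel t (0 :: real ^ 'n) *
        exp (- 256 * (pi ^ 3 + 1024 * pi * exp (- pi / 64)) * exp (- 4 * pi\<^sup>2 * t) * (norm \<xi>)\<^sup>2)
        \<le> heat_kernel t \<xi> \<and>
      heat_kernel t \<xi> \<le> heat_kernel t (0 :: real ^ 'n) *
        exp (- (16 / (1 + 4 * sqrt 2)) * exp (- 4 * pi\<^sup>2 * t) * (norm \<xi>)\<^sup>2)))"
proof (intro conjI allI impI ballI; (elim conjE)?)
  fix t :: real and \<xi> :: "real ^ 'n"
  assume t: "0 < t" "t < 1 / 2 ^ 8" and \<xi>: "\<xi> \<in> torus"
  have "heat_kernel t (0 :: real ^ 'n) * exp (- (1 / (4 * t)) * (norm \<xi>)\<^sup>2) \<le> heat_kernel t \<xi>"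
    using t by (intro heat_kernel_ge \<xi> gauss_sum_ge) auto
  thus "heat_kernel t (0 :: real ^ 'n) * exp (- (norm \<xi>)\<^sup>2 / (4 * t)) \<le> heat_kernel t \<xi>" by simp
  have "heat_kernel t \<xi> \<le> heat_kernel t (0 :: real ^ 'n) * exp (- (1 / (4 * t) / 10) * (norm \<xi>)\<^sup>2)"
    using t by (intro heat_kernel_le \<xi> gauss_sum_le_small_time) (auto simp: field_simps)
  thus "heat_kernel t \<xi> \<le> heat_kernel t (0 :: real ^ 'n) * exp (- (norm \<xi>)\<^sup>2 / (40 * t))" by simp
next
  fix t :: real and \<xi> :: "real ^ 'n"
  assume t: "1 / 2 ^ 8 \<le> t" and \<xi>: "\<xi> \<in> torus"
  have t': "1 / 256 \<le> t" "0 < t" using t by auto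
  show "heat_kernel t (0 :: real ^ 'n) *
      exp (- 256 * (pi ^ 3 + 1024 * pi * exp (- pi / 64)) * exp (- 4 * pi\<^sup>2 * t) * (norm \<xi>)\<^sup>2)
    \<le> heat_kernel t \<xi>"
    by (intro heat_kernel_ge \<xi> gauss_sum_ge_large_time t')
  show "heat_kernel t \<xi> \<le> heat_kernel t (0 :: real ^ 'n) *
      exp (- (16 / (1 + 4 * sqrt 2)) * exp (- 4 * pi\<^sup>2 * t) * (norm \<xi>)\<^sup>2)"
    by (intro heat_kernel_le \<xi> gauss_sum_le_large_time t')
qed

end
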